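(* For every $n\ge 100$, the number of nonisomorphic semimodular vi-lattices of rank three with exactly $n$ elements is at least $\big(0.3286\, n^{1/8}\big)^n$.
   Context: A finite lattice is semimodular if whenever $a,b$ both cover $a\wedge b$, then $a\vee b$ covers both $a$ and $b$. A vi-lattice (vertically indecomposable lattice) is a finite lattice that is not a vertical sum (top of one identified with the bottom of the other) of two non-singleton lattices. Rank three means every maximal chain has length three. *)

theory Defs
  imports Complex_Main "HOL-Algebra.Lattice"
begin

definition finite_lattice :: "'a gorder \<Rightarrow> bool" where
  "finite_lattice L \<longleftrightarrow> lattice L \<and> finite (carrier L) \<and> carrier L \<noteq> {}"

definition gorder_iso :: "'a gorder \<Rightarrow> 'b gorder \<Rightarrow> bool" where
  "gorder_iso L M \<longleftrightarrow> (\<exists>f. order_emb L M f \<and> bij_betw f (carrier L) (carrier M))"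

definition covers :: "'a gorder \<Rightarrow> 'a \<Rightarrow> 'a \<Rightarrow> bool" where
  "covers L b a \<longleftrightarrow> a \<in> carrier L \<and> b \<in> carrier L \<and> a \<sqsubset>\<^bsub>L\<^esub> b \<and>
     \<not> (\<exists>x\<in>carrier L. a \<sqsubset>\<^bsub>L\<^esub> x \<and> x \<sqsubset>\<^bsub>L\<^esub> b)"

definition semimodular :: "'a gorder \<Rightarrow> bool" where
  "semimodular L \<longleftrightarrow> (\<forall>a\<in>carrier L. \<forall>b\<in>carrier L.
     covers L a (a \<sqinter>\<^bsub>L\<^esub> b) \<and> covers L b (a \<sqinter>\<^bsub>L\<^esub> b) \<longrightarrow>
     covers L (a \<squnion>\<^bsub>L\<^esub> b) a \<and> covers L (a \<squnion>\<^bsub>L\<^esub> b) b)"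

(* A chain of length k has k covering steps, hence k + 1 elements. *)
definition has_rank :: "'a gorder \<Rightarrow> nat \<Rightarrow> bool" where
  "has_rank L k \<longleftrightarrow> (\<forall>C. pred_on.maxchain (carrier L) (\<sqsubset>\<^bsub>L\<^esub>) C \<longrightarrow> card C = k + 1)"

(* M is put on top of L. The identified point is represented by the copy of the top of L,
   so the bottom of M is removed from the disjoint union. *)
definition vertical_sum :: "'a gorder \<Rightarrow> 'b gorder \<Rightarrow> ('a + 'b) gorder" where
  "vertical_sum L M =
     \<lparr> carrier = Inl ` carrier L \<union> Inr ` (carrier M - {\<bottom>\<^bsub>M\<^esub>}),
       eq = (=),
       le = (\<lambda>x y. case (x, y) of
               (Inl a, Inl b) \<Rightarrow> a \<sqsubseteq>\<^bsub>L\<^esub> b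
             | (Inr a, Inr b) \<Rightarrow> a \<sqsubseteq>\<^bsub>M\<^esub> b
             | (Inl a, Inr b) \<Rightarrow> True
             | (Inr a, Inl b) \<Rightarrow> False) \<rparr>"

(* Summands of a lattice on 'a embed into it, so letting A and B range over orders
   on the same type 'a is no restriction. *)
definition vi_lattice :: "'a gorder \<Rightarrow> bool" where
  "vi_lattice L \<longleftrightarrow> finite_lattice L \<and>
     \<not> (\<exists>(A :: 'a gorder) (B :: 'a gorder). finite_lattice A \<and> finite_lattice B \<and>
          card (carrier A) \<noteq> 1 \<and> card (carrier B) \<noteq> 1 \<and>
          gorder_iso L (vertical_sum A B))"

definition semimodular_vi3 :: "nat \<Rightarrow> nat gorder set" where
  "semimodular_vi3 n =
     {L. carrier L = {..<n} \<and> vi_lattice L \<and> semimodular L \<and> has_rank L 3}"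

definition iso_rel :: "'a gorder set \<Rightarrow> ('a gorder \<times> 'a gorder) set" where
  "iso_rel X = {(L, M). L \<in> X \<and> M \<in> X \<and> gorder_iso L M}"

definition num_semimodular_vi3 :: "nat \<Rightarrow> nat" where
  "num_semimodular_vi3 n = card (semimodular_vi3 n // iso_rel (semimodular_vi3 n))"

(* The order of a record is unconstrained outside its carrier, so semimodular_vi3 n is in general
   infinite; the next two facts show that the set of isomorphism classes is nevertheless finite,
   so that its card is the intended number. *)

lemma equiv_iso_rel_semimodular_vi3:
  "equiv (semimodular_vi3 n) (iso_rel (semimodular_vi3 n))"
proof (rule equivI)
  let ?X = "semimodular_vi3 n"
  have po: "weak_partial_order L" if "L \<in> ?X" for L
    using that unfolding semimodular_vi3_def vi_lattice_def finite_lattice_def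
    by (auto simp: lattice_def upper_semilattice_def partial_order_def)
  show "iso_rel ?X \<subseteq> ?X \<times> ?X"
    by (auto simp: iso_rel_def)
  show "refl_on ?X (iso_rel ?X)"
  proof (rule refl_onI)
    fix L assume "L \<in> ?X"
    then have "order_emb L L id" "bij_betw id (carrier L) (carrier L)"
      using po by (auto simp: order_emb_def)
    with \<open>L \<in> ?X\<close> show "(L, L) \<in> iso_rel ?X"
      by (auto simp: iso_rel_def gorder_iso_def)
  qed
  show "sym (iso_rel ?X)"
  proof (rule symI)
    fix L M assume "(L, M) \<in> iso_rel ?X"
    then obtain f where X: "L \<in> ?X" "M \<in> ?X"
      and f: "order_emb L M f" "bij_betw f (carrier L) (carrier M)"
      by (auto simp: iso_rel_def gorder_iso_def)
    let ?g = "inv_into (carrier L) f"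
    have g: "bij_betw ?g (carrier M) (carrier L)"
      using f(2) by (rule bij_betw_inv_into)
    have "x \<sqsubseteq>\<^bsub>M\<^esub> y \<longleftrightarrow> ?g x \<sqsubseteq>\<^bsub>L\<^esub> ?g y" if "x \<in> carrier M" "y \<in> carrier M" for x y
      using that f bij_betwE[OF g] bij_betw_inv_into_right[OF f(2)]
      unfolding order_emb_def by metis
    then have "order_emb M L ?g"
      using po X bij_betwE[OF g] unfolding order_emb_def by auto
    with g X show "(M, L) \<in> iso_rel ?X"
      by (auto simp: iso_rel_def gorder_iso_def)
  qed
  show "trans (iso_rel ?X)"
  proof (rule transI)
    fix L M N assume "(L, M) \<in> iso_rel ?X" "(M, N) \<in> iso_rel ?X"
    then obtain f g where X: "L \<in> ?X" "N \<in> ?X"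
      and f: "order_emb L M f" "bij_betw f (carrier L) (carrier M)"
      and g: "order_emb M N g" "bij_betw g (carrier M) (carrier N)"
      by (auto simp: iso_rel_def gorder_iso_def)
    have "order_emb L N (g \<circ> f)"
      using f g bij_betwE[OF f(2)] unfolding order_emb_def by auto
    moreover have "bij_betw (g \<circ> f) (carrier L) (carrier N)"
      using f(2) g(2) by (rule bij_betw_trans)
    ultimately show "(L, N) \<in> iso_rel ?X"
      using X by (auto simp: iso_rel_def gorder_iso_def)
  qed
qed

lemma finite_semimodular_vi3_classes:
  "finite (semimodular_vi3 n // iso_rel (semimodular_vi3 n))"
proof -
  let ?X = "semimodular_vi3 n"
  let ?G = "\<lambda>L :: nat gorder. {(x, y). x < n \<and> y < n \<and> x \<sqsubseteq>\<^bsub>L\<^esub> y}"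
  have same: "iso_rel ?X `` {L} = iso_rel ?X `` {M}"
    if X: "L \<in> ?X" "M \<in> ?X" and G: "?G L = ?G M" for L M
  proof -
    have c: "carrier L = {..<n}" "carrier M = {..<n}"
      using X by (auto simp: semimodular_vi3_def)
    have po: "weak_partial_order L" "weak_partial_order M"
      using X unfolding semimodular_vi3_def vi_lattice_def finite_lattice_def
      by (auto simp: lattice_def upper_semilattice_def partial_order_def)
    have "x \<sqsubseteq>\<^bsub>L\<^esub> y \<longleftrightarrow> x \<sqsubseteq>\<^bsub>M\<^esub> y" if "x < n" "y < n" for x y
      using G that by (auto simp: set_eq_iff)
    then have "order_emb L M id"
      using po c by (auto simp: order_emb_def)
    moreover have "bij_betw id (carrier L) (carrier M)"
      using c by simp
    ultimately have "(L, M) \<in> iso_rel ?X"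
      using X by (auto simp: iso_rel_def gorder_iso_def)
    then show ?thesis
      by (rule equiv_class_eq[OF equiv_iso_rel_semimodular_vi3])
  qed
  define h where "h \<equiv> \<lambda>R. iso_rel ?X `` {SOME L. L \<in> ?X \<and> ?G L = R}"
  have "?X // iso_rel ?X \<subseteq> h ` Pow ({..<n} \<times> {..<n})"
  proof
    fix C assume "C \<in> ?X // iso_rel ?X"
    then obtain L where L: "L \<in> ?X" "C = iso_rel ?X `` {L}"
      by (rule quotientE)
    have "(SOME M. M \<in> ?X \<and> ?G M = ?G L) \<in> ?X \<and> ?G (SOME M. M \<in> ?X \<and> ?G M = ?G L) = ?G L"
      by (rule someI[of "\<lambda>M. M \<in> ?X \<and> ?G M = ?G L" L]) (use L in simp)
    then have "C = h (?G L)"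
      unfolding h_def L(2) using same L(1) by blast
    moreover have "?G L \<in> Pow ({..<n} \<times> {..<n})"
      by auto
    ultimately show "C \<in> h ` Pow ({..<n} \<times> {..<n})"
      by blast
  qed
  then show ?thesis
    by (rule finite_subset) simp
qed

end

theory Submission
  imports Defs "HOL-Algebra.Complete_Lattice"
begin

text \<open>
  A linear space (any two points lie on exactly one line) whose point set is not a line gives, by
  adding a bottom and a top, a semimodular vi-lattice of rank three, and additional one-point lines
  adjust its size. Linear spaces come from proper edge colourings of the complete graph on \<open>v\<close>
  vertices with \<open>m\<close> colours: the points are the vertices and the colours, the lines are the triples
  consisting of an edge and its colour, the pairs of a vertex and a colour missing at it, and the
  set of all colours. Colouring greedily, every edge has at least \<open>m - 2 v\<close> admissible colours, so
  there are at least \<open>(m - 2 v)\<close> to the power \<open>v choose 2\<close> colourings. A colouring is recovered from its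
  lattice and the labelling of the \<open>v + m\<close> points, so at most \<open>(v + m)\<close> to the power \<open>v + m\<close> of them
  give the same isomorphism class. With \<open>v = 4 t\<close> and \<open>m = 9 t\<close> about \<open>28 t\<^sup>2\<close> elements suffice for more than
  \<open>t\<close> to the power \<open>(8 - \<epsilon>) t\<^sup>2\<close> lattices, and \<open>n\<close> to the power \<open>n / 8\<close> is only about \<open>t\<close> to the power \<open>7 t\<^sup>2\<close>.
  For \<open>n < 7000\<close> the claimed bound is at most \<open>1\<close>.
\<close>

section \<open>Lattices of rank three\<close>

text \<open>An explicit rank function reduces the conditions of \<open>semimodular_vi3\<close> to
  facts that can be checked on sets of points: \<open>coatom_above\<close> yields semimodularity,
  the existence of intermediate elements yields rank three, and \<open>incomparable\<close> yields
  vertical indecomposability. The case \<open>a = b\<close> of \<open>coatom_above\<close> provides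
  a coatom above every atom.\<close>

locale ranked3 = lattice L for L :: "'a gorder" (structure) +
  fixes r :: "'a \<Rightarrow> nat" and bot top :: 'a
  assumes finite_carrier: "finite (carrier L)"
    and bot: "bot \<in> carrier L" "r bot = 0" "\<And>x. x \<in> carrier L \<Longrightarrow> bot \<sqsubseteq> x"
    and top: "top \<in> carrier L" "r top = 3" "\<And>x. x \<in> carrier L \<Longrightarrow> x \<sqsubseteq> top"
    and rank_less: "\<And>x y. x \<in> carrier L \<Longrightarrow> y \<in> carrier L \<Longrightarrow> x \<sqsubset> y \<Longrightarrow> r x < r y"
    and atom_exists: "\<exists>a\<in>carrier L. r a = 1"
    and atom_below: "\<And>x. x \<in> carrier L \<Longrightarrow> r x = 2 \<Longrightarrow> \<exists>a\<in>carrier L. r a = 1 \<and> a \<sqsubseteq> x"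
    and coatom_above: "\<And>a b. a \<in> carrier L \<Longrightarrow> b \<in> carrier L \<Longrightarrow> r a = 1 \<Longrightarrow> r b = 1 \<Longrightarrow>
           \<exists>l\<in>carrier L. r l = 2 \<and> a \<sqsubseteq> l \<and> b \<sqsubseteq> l"
    and incomparable: "\<And>x. x \<in> carrier L \<Longrightarrow> x \<noteq> bot \<Longrightarrow> x \<noteq> top \<Longrightarrow>
           \<exists>y\<in>carrier L. \<not> x \<sqsubseteq> y \<and> \<not> y \<sqsubseteq> x"
begin

lemma rank_0: "x \<in> carrier L \<Longrightarrow> r x = 0 \<Longrightarrow> x = bot"
  using rank_less[of bot x] bot lless_eq[of bot x] by auto

lemma rank_3: "x \<in> carrier L \<Longrightarrow> r x \<ge> 3 \<Longrightarrow> x = top"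
  using rank_less[of x top] top lless_eq[of x top] by fastforce

lemma rank_le: "x \<in> carrier L \<Longrightarrow> r x \<le> 3"
  using rank_3[of x] top(2) by (cases "r x \<ge> 3") auto

lemma le_rank_eq: "x \<in> carrier L \<Longrightarrow> y \<in> carrier L \<Longrightarrow> x \<sqsubseteq> y \<Longrightarrow> r y \<le> r x \<Longrightarrow> x = y"
  using rank_less[of x y] lless_eq[of x y] by fastforce

lemma lless_rankI: "x \<sqsubseteq> y \<Longrightarrow> r x < r y \<Longrightarrow> x \<sqsubset> y"
  by (auto simp: lless_eq)

text \<open>Only the ranks 1 and 2 can lie strictly between. For \<open>k = 1\<close> the lower
  element is \<open>bot\<close>, and an atom below \<open>y\<close> serves; for \<open>k = 2\<close>
  the upper element is \<open>top\<close>, and a coatom above an atom that lies above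
  \<open>x\<close> serves.\<close>

lemma rank_interpolate:
  assumes xy: "x \<in> carrier L" "y \<in> carrier L" and k: "r x < k" "k < r y" and le: "x \<sqsubset> y"
  shows "\<exists>z\<in>carrier L. r z = k \<and> x \<sqsubset> z \<and> z \<sqsubset> y"
proof -
  have "r y \<le> 3" using xy rank_le by auto
  then consider "k = 1" | "k = 2" using k by linarith
  then have "\<exists>z\<in>carrier L. r z = k \<and> x \<sqsubseteq> z \<and> z \<sqsubseteq> y"
  proof cases
    case 1
    then have x: "x = bot" using k rank_0 xy by simp
    show ?thesis
    proof (cases "r y = 2")
      case True
      then show ?thesis using atom_below[of y] xy x bot 1 by auto
    next
      case False
      then have "y = top" using rank_3 xy k 1 by simp
      then show ?thesis using atom_exists x bot top 1 by auto
    qed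
  next
    case 2
    then have y: "y = top" using k rank_3 xy by simp
    obtain a where "a \<in> carrier L" "r a = 1" "x \<sqsubseteq> a"
    proof (cases "r x = 1")
      case True then show ?thesis using that xy by auto
    next
      case False
      then have "x = bot" using k rank_0 xy 2 by simp
      then show ?thesis using atom_exists bot that by auto
    qed
    then show ?thesis using coatom_above[of a a] y top 2 le_trans xy by meson
  qed
  then show ?thesis using k lless_rankI by metis
qed

lemma covers_iff:
  assumes "x \<in> carrier L" "y \<in> carrier L"
  shows "covers L y x \<longleftrightarrow> x \<sqsubset> y \<and> r y = Suc (r x)"
proof
  assume c: "covers L y x"
  then have "x \<sqsubset> y" "r x < r y" using assms rank_less by (auto simp: covers_def)
  moreover have "\<not> Suc (r x) < r y"
    using c rank_interpolate[of x y "Suc (r x)"] assms unfolding covers_def by blast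
  ultimately show "x \<sqsubset> y \<and> r y = Suc (r x)" by auto
next
  assume "x \<sqsubset> y \<and> r y = Suc (r x)"
  then show "covers L y x"
    using assms rank_less unfolding covers_def
    by (metis less_Suc_eq not_less_eq less_asym)
qed

text \<open>If \<open>a\<close> and \<open>b\<close> are atoms, a common coatom keeps their join at
  rank 2; otherwise they have rank at least 2 and the join cannot exceed rank 3. Either way the rank
  rises by exactly one, which is covering by \<open>covers_iff\<close>.\<close>

lemma semimodular: "semimodular L"
  unfolding semimodular_def
proof (intro ballI impI, elim conjE)
  fix a b assume ab: "a \<in> carrier L" "b \<in> carrier L"
    and c: "covers L a (a \<sqinter> b)" "covers L b (a \<sqinter> b)"
  let ?m = "a \<sqinter> b" and ?j = "a \<squnion> b"
  have m: "?m \<in> carrier L" and j: "?j \<in> carrier L" using ab by auto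
  have r: "?m \<sqsubset> a" "?m \<sqsubset> b" "r a = Suc (r ?m)" "r b = Suc (r ?m)"
    using c covers_iff ab m by auto
  have le: "a \<sqsubseteq> ?j" "b \<sqsubseteq> ?j" using ab join_left join_right by auto
  have "a \<noteq> b"
  proof
    assume "a = b"
    then have "a \<sqsubseteq> ?m" using meet_le[of a a b] ab by simp
    then show False using r(1) lless_eq le_antisym ab m by blast
  qed
  \<comment> \<open>Distinct elements of equal rank are incomparable, so the join is strictly above
    both.\<close>
  then have ne: "a \<noteq> ?j" "b \<noteq> ?j"
    using le le_rank_eq[of a b] le_rank_eq[of b a] ab r by auto
  then have l: "a \<sqsubset> ?j" "b \<sqsubset> ?j" using le by (auto simp: lless_eq)
  then have lt: "r a < r ?j" using rank_less ab j by auto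
  have "r ?j \<le> Suc (r a)"
  proof (cases "r a = 1")
    case True
    then obtain l where "l \<in> carrier L" "r l = 2" "a \<sqsubseteq> l" "b \<sqsubseteq> l"
      using coatom_above[of a b] ab r by auto
    then have "?j \<sqsubseteq> l" "r l = 2" "l \<in> carrier L" using join_le ab by auto
    then show ?thesis using rank_less[of ?j l] True j lless_eq[of ?j l] by fastforce
  next
    case False
    then show ?thesis using r rank_le[OF j] lt by linarith
  qed
  then have "r ?j = Suc (r a)" using lt by simp
  then show "covers L ?j a \<and> covers L ?j b" using covers_iff ab j l r by simp
qed

text \<open>The rank is injective on a chain, so it suffices that a maximal chain meets all ranks
  from 0 to 3. If rank \<open>k\<close> were missing, an element of rank \<open>k\<close>
  interpolated between the nearest chain members below and above would be comparable with the whole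
  chain, against maximality.\<close>

lemma has_rank: "has_rank L 3"
  unfolding has_rank_def
proof (intro allI impI)
  fix C assume "pred_on.maxchain (carrier L) (\<sqsubset>) C"
  then have ch: "pred_on.chain (carrier L) (\<sqsubset>) C"
    and max: "\<And>S. pred_on.chain (carrier L) (\<sqsubset>) S \<Longrightarrow> \<not> C \<subset> S"
    by (auto simp: pred_on.maxchain_def)
  have sub: "C \<subseteq> carrier L" and cmp: "\<And>x y. x \<in> C \<Longrightarrow> y \<in> C \<Longrightarrow> x \<sqsubset> y \<or> y \<sqsubset> x \<or> x = y"
    using ch by (auto simp: pred_on.chain_def)
  have ins: "z \<in> C" if "z \<in> carrier L" "\<And>w. w \<in> C \<Longrightarrow> w \<sqsubset> z \<or> z \<sqsubset> w \<or> w = z" for z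
  proof (rule ccontr)
    assume "z \<notin> C"
    moreover have "pred_on.chain (carrier L) (\<sqsubset>) (insert z C)"
      using that sub cmp unfolding pred_on.chain_def by blast
    ultimately show False using max by blast
  qed
  have inj: "inj_on r C"
    using cmp rank_less sub by (intro inj_onI) (metis less_irrefl subsetD)
  have b: "bot \<in> C" using bot sub by (intro ins) (auto simp: lless_eq)
  have t: "top \<in> C" using top sub by (intro ins) (auto simp: lless_eq)
  have less: "w \<sqsubset> x" if "w \<in> C" "x \<in> C" "r w < r x" for w x
    using cmp[of w x] that rank_less[of x w] sub by auto
  have mid: "k \<in> r ` C" if k: "0 < k" "k < 3" for k
  proof (rule ccontr)
    assume nk: "k \<notin> r ` C"
    have fin: "finite C" using sub finite_carrier finite_subset by blast
    obtain x where x: "x \<in> C" "r x < k" "\<And>w. w \<in> C \<Longrightarrow> r w < k \<Longrightarrow> r w \<le> r x"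
    proof -
      let ?S = "{w \<in> C. r w < k}"
      have "finite (r ` ?S)" "r ` ?S \<noteq> {}" using fin b bot k by auto
      then have "Max (r ` ?S) \<in> r ` ?S" "\<And>w. w \<in> ?S \<Longrightarrow> r w \<le> Max (r ` ?S)"
        using Max_in Max_ge by auto
      then show ?thesis using that by (auto simp: image_iff)
    qed
    obtain y where y: "y \<in> C" "k < r y" "\<And>w. w \<in> C \<Longrightarrow> k < r w \<Longrightarrow> r y \<le> r w"
    proof -
      let ?S = "{w \<in> C. k < r w}"
      have "finite (r ` ?S)" "r ` ?S \<noteq> {}" using fin t top k by auto
      then have "Min (r ` ?S) \<in> r ` ?S" "\<And>w. w \<in> ?S \<Longrightarrow> Min (r ` ?S) \<le> r w"
        using Min_in Min_le by auto
      then show ?thesis using that by (auto simp: image_iff)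
    qed
    have "x \<sqsubset> y" using less x y by auto
    then obtain z where z: "z \<in> carrier L" "r z = k" "x \<sqsubset> z" "z \<sqsubset> y"
      using rank_interpolate[of x y k] x y sub by blast
    have "z \<in> C"
    proof (rule ins[OF z(1)])
      fix w assume w: "w \<in> C"
      then have "r w \<noteq> k" using nk by auto
      then consider "r w < k" | "k < r w" by linarith
      then show "w \<sqsubset> z \<or> z \<sqsubset> w \<or> w = z"
      proof cases
        case 1
        then have "w = x \<or> w \<sqsubset> x"
          using x(3)[OF w] cmp[OF w x(1)] rank_less[of x w] x(1) w sub by (meson leD subsetD)
        then show ?thesis using z lless_trans[of w x z] w x sub by auto
      next
        case 2
        then have "w = y \<or> y \<sqsubset> w"
          using y(3)[OF w] cmp[OF w y(1)] rank_less[of w y] y(1) w sub by (meson leD subsetD)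
        then show ?thesis using z lless_trans[of z y w] w y sub by auto
      qed
    qed
    then show False using nk z by auto
  qed
  have "r ` C = {0..3}"
  proof
    show "r ` C \<subseteq> {0..3}" using rank_le sub by auto
    show "{0..3} \<subseteq> r ` C"
    proof
      fix k :: nat assume "k \<in> {0..3}"
      then consider "k = 0" | "0 < k" "k < 3" | "k = 3" by fastforce
      then show "k \<in> r ` C"
        by cases (use mid b bot(2) t top(2) image_eqI[of _ r] in \<open>metis (no_types)\<close>)+
    qed
  qed
  then have "card C = card {0..3::nat}" using card_image[OF inj] by simp
  then show "card C = 3 + 1" by simp
qed

lemma finite_lattice: "finite_lattice L"
  unfolding finite_lattice_def using lattice_axioms finite_carrier bot(1) by auto

end

section \<open>Vertical indecomposability\<close>

lemma finite_lattice_has_top: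
  assumes "finite_lattice A"
  shows "\<exists>t\<in>carrier A. \<forall>x\<in>carrier A. x \<sqsubseteq>\<^bsub>A\<^esub> t"
proof -
  interpret lattice A using assms by (simp add: finite_lattice_def)
  \<comment> \<open>Joining one element at a time bounds every finite subset; the carrier itself is
    the case of interest.\<close>
  have "\<exists>t\<in>carrier A. \<forall>x\<in>S. x \<sqsubseteq>\<^bsub>A\<^esub> t" if "finite S" "S \<subseteq> carrier A" for S
    using that
  proof (induction S)
    case empty
    then show ?case using assms by (auto simp: finite_lattice_def)
  next
    case (insert y S)
    then obtain t where t: "t \<in> carrier A" "\<forall>x\<in>S. x \<sqsubseteq>\<^bsub>A\<^esub> t" by auto
    have y: "y \<in> carrier A" "S \<subseteq> carrier A" using insert.prems by auto
    have j: "t \<squnion>\<^bsub>A\<^esub> y \<in> carrier A" using t y by simp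
    have "x \<sqsubseteq>\<^bsub>A\<^esub> t \<squnion>\<^bsub>A\<^esub> y" if "x \<in> insert y S" for x
    proof (cases "x = y")
      case True
      then show ?thesis using join_right t(1) y(1) by simp
    next
      case False
      then have x: "x \<in> carrier A" "x \<sqsubseteq>\<^bsub>A\<^esub> t" using that t y by auto
      show ?thesis by (rule le_trans[OF x(2) join_left[OF t(1) y(1)] x(1) t(1) j])
    qed
    then show ?case using j by blast
  qed
  then show ?thesis using assms by (auto simp: finite_lattice_def)
qed

text \<open>The glued point, the top of \<open>A\<close>, is comparable with everything in a
  vertical sum. By \<open>incomparable\<close> its preimage is \<open>bot\<close> or
  \<open>top\<close>, and then \<open>A\<close> or \<open>B\<close> respectively is a
  singleton.\<close>

lemma (in ranked3) vi_lattice: "vi_lattice L"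
  unfolding vi_lattice_def
proof (intro conjI notI, rule finite_lattice, elim exE conjE)
  fix A B :: "'a gorder"
  assume A: "finite_lattice A" and B: "finite_lattice B"
    and cA: "card (carrier A) \<noteq> 1" and cB: "card (carrier B) \<noteq> 1"
    and iso: "gorder_iso L (vertical_sum A B)"
  obtain t where t: "t \<in> carrier A" "\<forall>x\<in>carrier A. x \<sqsubseteq>\<^bsub>A\<^esub> t"
    using finite_lattice_has_top[OF A] by auto
  let ?V = "vertical_sum A B"
  obtain f where emb: "\<And>x y. x \<in> carrier L \<Longrightarrow> y \<in> carrier L \<Longrightarrow> f x \<sqsubseteq>\<^bsub>?V\<^esub> f y \<longleftrightarrow> x \<sqsubseteq> y"
    and bij: "bij_betw f (carrier L) (carrier ?V)"
    using iso unfolding gorder_iso_def order_emb_def by auto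
  have cV: "carrier ?V = Inl ` carrier A \<union> Inr ` (carrier B - {\<bottom>\<^bsub>B\<^esub>})"
    by (simp add: vertical_sum_def)
  have img: "f ` carrier L = carrier ?V" using bij by (simp add: bij_betw_def)
  have "Inl t \<in> f ` carrier L" using img t(1) cV by auto
  then obtain p where p: "p \<in> carrier L" "f p = Inl t" by auto
  have "p \<sqsubseteq> y \<or> y \<sqsubseteq> p" if y: "y \<in> carrier L" for y
  proof -
    have "f y \<in> carrier ?V" using img y by auto
    then have "f p \<sqsubseteq>\<^bsub>?V\<^esub> f y \<or> f y \<sqsubseteq>\<^bsub>?V\<^esub> f p"
      unfolding cV p using t by (auto simp: vertical_sum_def)
    then show ?thesis using emb p(1) y by blast
  qed
  then have "p = bot \<or> p = top" using incomparable[of p] p by auto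
  then show False
  proof
    assume pb: "p = bot"
    have "x = t" if x: "x \<in> carrier A" for x
    proof -
      interpret A: lattice A using A by (simp add: finite_lattice_def)
      have "Inl x \<in> f ` carrier L" using img x cV by auto
      then obtain y where y: "y \<in> carrier L" "f y = Inl x" by auto
      then have "f p \<sqsubseteq>\<^bsub>?V\<^esub> f y" using emb[OF p(1) y(1)] pb bot(3) by simp
      then have "t \<sqsubseteq>\<^bsub>A\<^esub> x" unfolding p y by (simp add: vertical_sum_def)
      then show ?thesis using t x A.le_antisym[of x t] by simp
    qed
    then have "carrier A = {t}" using t(1) by blast
    then show False using cA by simp
  next
    assume pt: "p = top"
    have "x = \<bottom>\<^bsub>B\<^esub>" if x: "x \<in> carrier B" for x
    proof (rule ccontr)
      assume "x \<noteq> \<bottom>\<^bsub>B\<^esub>"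
      then have "Inr x \<in> f ` carrier L" using img x cV by auto
      then obtain y where y: "y \<in> carrier L" "f y = Inr x" by auto
      then have "f y \<sqsubseteq>\<^bsub>?V\<^esub> f p" using emb[OF y(1) p(1)] pt top(3) by simp
      then show False unfolding p y by (simp add: vertical_sum_def)
    qed
    moreover have "carrier B \<noteq> {}" using B by (simp add: finite_lattice_def)
    ultimately have "carrier B = {\<bottom>\<^bsub>B\<^esub>}" by blast
    then show False using cB by (metis is_singletonI is_singleton_altdef)
  qed
qed

section \<open>Linear spaces\<close>

text \<open>Strict inclusion in \<open>line_subset\<close> keeps every line different from the top
  and leaves a point off it, which later serves as an incomparable atom.\<close>

locale linear_space =
  fixes p :: nat and B :: "nat set set"
  assumes points: "2 \<le> p"
    and line_subset: "\<And>b. b \<in> B \<Longrightarrow> b \<subset> {..<p}"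
    and line_two: "\<And>b. b \<in> B \<Longrightarrow> \<exists>x\<in>b. \<exists>y\<in>b. x \<noteq> y"
    and line_through: "\<And>x y. x < p \<Longrightarrow> y < p \<Longrightarrow> x \<noteq> y \<Longrightarrow> \<exists>b\<in>B. x \<in> b \<and> y \<in> b"
    and line_unique: "\<And>x y b c. x \<noteq> y \<Longrightarrow> b \<in> B \<Longrightarrow> c \<in> B \<Longrightarrow>
           x \<in> b \<Longrightarrow> y \<in> b \<Longrightarrow> x \<in> c \<Longrightarrow> y \<in> c \<Longrightarrow> b = c"

text \<open>The sets \<open>{0, p + k}\<close> stand for lines with the single point \<open>0\<close>; the extra elements
  \<open>p + k\<close> only serve to keep them apart.\<close>

definition flats :: "nat \<Rightarrow> nat set set \<Rightarrow> nat \<Rightarrow> nat set set" where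
  "flats p B s = {{}, {..<p + s}} \<union> (\<lambda>x. {x}) ` {..<p} \<union> B \<union> (\<lambda>k. {0, p + k}) ` {..<s}"

definition rank_flat :: "nat \<Rightarrow> nat \<Rightarrow> nat set \<Rightarrow> nat" where
  "rank_flat p s A =
     (if A = {} then 0 else if A = {..<p + s} then 3 else if \<exists>x. A = {x} then 1 else 2)"

text \<open>\<open>semimodular_vi3\<close> prescribes the carrier \<open>{..<n}\<close>, so a family
  of sets enters through a numbering \<open>h\<close> of its members.\<close>

definition order_of :: "nat \<Rightarrow> (nat \<Rightarrow> nat set) \<Rightarrow> nat gorder" where
  "order_of n h = \<lparr> carrier = {..<n}, eq = (=), le = (\<lambda>x y. h x \<subseteq> h y) \<rparr>"

lemma order_of_simps [simp]:
  "carrier (order_of n h) = {..<n}" "eq (order_of n h) = (=)" "le (order_of n h) x y \<longleftrightarrow> h x \<subseteq> h y"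
  by (simp_all add: order_of_def)

lemma Inter_closed:
  assumes "finite S" "S \<noteq> {}" "S \<subseteq> F" "\<And>A B. A \<in> F \<Longrightarrow> B \<in> F \<Longrightarrow> A \<inter> B \<in> F"
  shows "\<Inter>S \<in> F"
  using assms(1-3) by (induction S rule: finite_ne_induct) (auto intro: assms(4))

lemma partial_order_order_of:
  assumes "inj_on h {..<n}"
  shows "partial_order (order_of n h)"
  using assms by unfold_locales (auto dest: inj_onD)

text \<open>Intersections are infima. The carrier is finite, so closure under binary intersection
  gives all nonempty infima, and together with the greatest set \<open>U\<close> these make the
  order a complete lattice.\<close>

lemma lattice_order_of:
  assumes h: "bij_betw h {..<n} F"
    and U: "U \<in> F" "\<And>A. A \<in> F \<Longrightarrow> A \<subseteq> U"
    and Int: "\<And>A B. A \<in> F \<Longrightarrow> B \<in> F \<Longrightarrow> A \<inter> B \<in> F"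
  shows "lattice (order_of n h)"
proof -
  let ?L = "order_of n h"
  have img: "h ` {..<n} = F" using h by (simp add: bij_betw_def)
  interpret partial_order ?L
    using h by (intro partial_order_order_of) (simp add: bij_betw_def)
  have "complete_lattice ?L"
  proof (rule complete_lattice_criterion1)
    obtain u where "u < n" "h u = U" using U img by auto
    then show "\<exists>g. greatest ?L g (carrier ?L)"
      using U img by (intro exI[of _ u]) (auto simp: greatest_def)
  next
    fix X assume X: "X \<subseteq> carrier ?L" "X \<noteq> {}"
    have "\<Inter> (h ` X) \<in> F"
      using X img by (intro Inter_closed Int) (auto intro: finite_subset)
    then obtain i where i: "i < n" "h i = \<Inter> (h ` X)" using img by fastforce
    show "\<exists>i. greatest ?L i (Lower ?L X)"
      using X i by (intro exI[of _ i]) (auto simp: greatest_def Lower_def)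
  qed
  then show ?thesis by (rule complete_lattice_lattice)
qed

section \<open>The flats of a linear space as a lattice of rank three\<close>

context linear_space
begin

lemma flats_cases:
  assumes "A \<in> flats p B s"
  obtains "A = {}" | "A = {..<p + s}" | x where "x < p" "A = {x}" | "A \<in> B"
    | k where "k < s" "A = {0, p + k}"
  using assms unfolding flats_def by auto

lemma flats_intros:
  "{} \<in> flats p B s" "{..<p + s} \<in> flats p B s" "x < p \<Longrightarrow> {x} \<in> flats p B s"
  "b \<in> B \<Longrightarrow> b \<in> flats p B s" "k < s \<Longrightarrow> {0, p + k} \<in> flats p B s"
  unfolding flats_def by auto

lemma finite_lines: "finite B"
  using line_subset by (intro finite_subset[of B "Pow {..<p}"]) auto

lemma line_not_singleton: "b \<in> B \<Longrightarrow> b \<noteq> {x}"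
  using line_two by fastforce

lemma line_nonempty: "b \<in> B \<Longrightarrow> b \<noteq> {}"
  using line_two by fastforce

lemma line_subset_eq: "b \<in> B \<Longrightarrow> c \<in> B \<Longrightarrow> b \<subseteq> c \<Longrightarrow> b = c"
  using line_two[of b] line_unique by blast

lemma line_not_top: "b \<in> B \<Longrightarrow> b \<noteq> {..<p + s}"
  using line_subset[of b] by auto

lemma line_point_less: "b \<in> B \<Longrightarrow> x \<in> b \<Longrightarrow> x < p"
  using line_subset[of b] by auto

lemma top_not_singleton: "{..<p + s} \<noteq> {x}"
proof
  assume "{..<p + s} = {x}"
  then have "card {..<p + s} = 1" by simp
  then show False using points by simp
qed

lemma other_point: "\<exists>y<p. y \<noteq> x"
  using points by (cases "x = 0") (auto intro: exI[of _ 1] exI[of _ 0])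

lemma top_not_empty: "{..<p + s} \<noteq> {}"
  using points by (simp add: lessThan_empty_iff)

lemma extra_not_top: "{0, p + k} \<noteq> {..<p + s}"
proof
  assume "{0, p + k} = {..<p + s}"
  then have "card {0, p + k} = p + s" "1 \<in> {0, p + k}" using points by auto
  then show False using points by auto
qed

lemma extra_not_line: "b \<in> B \<Longrightarrow> {0, p + k} \<noteq> b"
  using line_point_less by force

text \<open>Comparable flats are trivial, and incomparable ones share at most one point, which lies
  below \<open>p\<close>: two lines by \<open>line_unique\<close>, while an extra set
  \<open>{0, p + k}\<close> can share only \<open>0\<close> with a line or with another extra
  set.\<close>

lemma flats_Int:
  assumes "X \<in> flats p B s" "Y \<in> flats p B s"
  shows "X \<inter> Y \<in> flats p B s"
proof (cases "X \<subseteq> Y \<or> Y \<subseteq> X")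
  case True
  then show ?thesis using assms by (metis Int_absorb1 Int_absorb2)
next
  case False
  have small: "Z \<in> flats p B s" if "\<And>x y. x \<in> Z \<Longrightarrow> y \<in> Z \<Longrightarrow> x = y" "Z \<subseteq> {..<p}" for Z
  proof (cases "Z = {}")
    case False
    then obtain x where "x \<in> Z" by auto
    then have "Z = {x}" "x < p" using that by auto
    then show ?thesis using flats_intros by simp
  qed (simp add: flats_intros)
  have top: "Z \<subseteq> {..<p + s}" if "Z \<in> flats p B s" for Z
    using that points by (cases rule: flats_cases) (auto dest: line_point_less)
  have ncard: "X \<noteq> {}" "Y \<noteq> {}" "X \<noteq> {..<p + s}" "Y \<noteq> {..<p + s}"
    using False top assms by auto
  show ?thesis
  proof (rule small)
    fix x y assume xy: "x \<in> X \<inter> Y" "y \<in> X \<inter> Y"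
    from assms(1) show "x = y"
    proof (cases rule: flats_cases)
      case X: 4
      from assms(2) show ?thesis
      proof (cases rule: flats_cases)
        case 4 then show ?thesis using X xy False line_unique[of x y X Y] by auto
      next
        case 5 then show ?thesis using X xy line_point_less[of X] by force
      qed (use ncard xy in auto)
    next
      case X: (5 k)
      from assms(2) show ?thesis
      proof (cases rule: flats_cases)
        case 4 then show ?thesis using X xy line_point_less[of Y] by force
      next
        case (5 k') then show ?thesis using X xy False points by auto
      qed (use ncard xy in auto)
    qed (use ncard xy in auto)
  next
    show "X \<inter> Y \<subseteq> {..<p}"
    proof -
      have "X \<subseteq> {..<p} \<or> Y \<subseteq> {..<p} \<or> X \<inter> Y \<subseteq> {0}"
        using assms(1)
      proof (cases rule: flats_cases)
        case X: (5 k)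
        from assms(2) show ?thesis
        proof (cases rule: flats_cases)
          case (5 k') then show ?thesis using X False by auto
        qed (use ncard in \<open>auto dest: line_point_less\<close>)
      qed (use ncard in \<open>auto dest: line_point_less\<close>)
      then show ?thesis using points by auto
    qed
  qed
qed

text \<open>The four families making up \<open>flats\<close> are disjoint and indexed injectively.
  Hence \<open>s\<close> can be chosen to reach any prescribed size from
  \<open>2 + p + card B\<close> on.\<close>

lemma card_flats: "card (flats p B s) = 2 + p + card B + s"
proof -
  have 1: "card {{}, {..<p + s}} = 2" using top_not_empty[of s] by (simp add: card_insert_if)
  have 2: "card ((\<lambda>x. {x}) ` {..<p}) = p" by (subst card_image) (auto simp: inj_on_def)
  have 3: "card ((\<lambda>k. {0, p + k}) ` {..<s}) = s"
    using points by (subst card_image) (auto simp: inj_on_def doubleton_eq_iff)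
  have d1: "{{}, {..<p + s}} \<inter> (\<lambda>x. {x}) ` {..<p} = {}"
    using top_not_singleton by auto
  have d2: "({{}, {..<p + s}} \<union> (\<lambda>x. {x}) ` {..<p}) \<inter> B = {}"
    using line_not_singleton line_not_top line_nonempty by blast
  have d3: "({{}, {..<p + s}} \<union> (\<lambda>x. {x}) ` {..<p} \<union> B) \<inter> (\<lambda>k. {0, p + k}) ` {..<s} = {}"
  proof -
    have "{0, p + k} \<noteq> {x}" for k x using points by auto
    then have "{0, p + k} \<notin> {{}, {..<p + s}} \<union> (\<lambda>x. {x}) ` {..<p} \<union> B" for k
      using extra_not_line[of "{0, p + k}" k] extra_not_top[of k s] by fastforce
    then show ?thesis by blast
  qed
  show ?thesis
    unfolding flats_def
    using card_Un_disjoint[OF _ _ d1] card_Un_disjoint[OF _ _ d2] card_Un_disjoint[OF _ _ d3] 1 2 3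
      finite_lines by simp
qed

lemma flat_has_point:
  assumes "X \<in> flats p B s" "X \<noteq> {}"
  shows "\<exists>y<p. y \<in> X"
  using assms(1)
proof (cases rule: flats_cases)
  case 4
  then obtain y where "y \<in> X" using line_nonempty by blast
  then show ?thesis using 4 line_point_less by blast
next
  case 5
  then show ?thesis using points by (intro exI[of _ 0]) simp
next
  case 2
  then show ?thesis using points by (intro exI[of _ 0]) simp
qed (use assms(2) in auto)

lemma rank_flat_simps:
  "rank_flat p s {} = 0" "rank_flat p s {..<p + s} = 3" "rank_flat p s {x} = 1"
  "b \<in> B \<Longrightarrow> rank_flat p s b = 2" "k < s \<Longrightarrow> rank_flat p s {0, p + k} = 2"
proof -
  show "rank_flat p s {..<p + s} = 3" using top_not_empty[of s] by (simp add: rank_flat_def)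
  show "rank_flat p s {x} = 1" using top_not_singleton by (auto simp: rank_flat_def)
  show "b \<in> B \<Longrightarrow> rank_flat p s b = 2"
    using line_not_singleton line_not_top line_nonempty by (auto simp: rank_flat_def)
  have "\<not> (\<exists>x. {0, p + k} = {x})" using points by auto
  then show "k < s \<Longrightarrow> rank_flat p s {0, p + k} = 2"
    using extra_not_top[of k s] by (auto simp: rank_flat_def)
qed (simp add: rank_flat_def)

text \<open>The point is that lines and extra sets together form an antichain: a line has two points
  below \<open>p\<close> and so does not fit into \<open>{0, p + k}\<close>, and
  \<open>p + k\<close> lies on no line.\<close>

lemma rank_flat_less:
  assumes "X \<in> flats p B s" "Y \<in> flats p B s" "X \<subset> Y"
  shows "rank_flat p s X < rank_flat p s Y"
proof -
  have top: "Z \<subseteq> {..<p + s}" if "Z \<in> flats p B s" for Z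
    using that points by (cases rule: flats_cases) (auto dest: line_point_less)
  from assms(1) show ?thesis
  proof (cases rule: flats_cases)
    case 1
    then show ?thesis using assms(3) by (auto simp: rank_flat_def)
  next
    case 2
    then show ?thesis using assms top by auto
  next
    case X: (3 x)
    from assms(2) show ?thesis
      by (cases rule: flats_cases) (use X assms(3) rank_flat_simps in auto)
  next
    case X: 4
    from assms(2) show ?thesis
    proof (cases rule: flats_cases)
      case 4 then show ?thesis using X assms(3) line_subset_eq by auto
    next
      case (5 k)
      have "X \<subseteq> {0}" using X assms(3) 5 line_point_less by force
      then show ?thesis using X line_two by blast
    next
      case 2 then show ?thesis using X rank_flat_simps by auto
    next
      case 3 then show ?thesis using X assms(3) line_nonempty by auto
    qed (use assms(3) in auto)
  next
    case X: (5 k)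
    from assms(2) show ?thesis
    proof (cases rule: flats_cases)
      case 4
      then have "p + k < p" using X assms(3) line_point_less by blast
      then show ?thesis by simp
    next
      case (5 k')
      then have "p + k \<in> {0, p + k'}" using X assms(3) by blast
      then have "X = Y" using X 5 points by simp
      then show ?thesis using assms(3) by simp
    next
      case 2 then show ?thesis using X rank_flat_simps by auto
    next
      case 3 then show ?thesis using X assms(3) points by auto
    qed (use assms(3) in auto)
  qed
qed

text \<open>The singleton of a point below \<open>p\<close> outside the flat always works; for an
  extra set this is \<open>{1}\<close>.\<close>

lemma flat_incomparable:
  assumes "X \<in> flats p B s" "X \<noteq> {}" "X \<noteq> {..<p + s}"
  shows "\<exists>Y\<in>flats p B s. \<not> X \<subseteq> Y \<and> \<not> Y \<subseteq> X"
  using assms(1)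
proof (cases rule: flats_cases)
  case (3 x)
  obtain y where "y < p" "y \<noteq> x" using other_point by auto
  then show ?thesis using 3 flats_intros(3)[of y] by (intro bexI[of _ "{y}"]) auto
next
  case 4
  then obtain y where "y < p" "y \<notin> X" using line_subset by blast
  then show ?thesis using 4 flats_intros(3)[of y] line_not_singleton[of X y] line_nonempty
    by (intro bexI[of _ "{y}"]) auto
next
  case (5 k)
  then show ?thesis using points flats_intros(3)[of 1] by (intro bexI[of _ "{1}"]) auto
qed (use assms in auto)

lemma ranked3_order_of_flats:
  assumes h: "bij_betw h {..<n} (flats p B s)"
  shows "ranked3 (order_of n h) (rank_flat p s \<circ> h)
           (inv_into {..<n} h {}) (inv_into {..<n} h {..<p + s})"
proof -
  let ?L = "order_of n h" and ?F = "flats p B s"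
  have img: "h ` {..<n} = ?F" and inj: "inj_on h {..<n}" using h by (auto simp: bij_betw_def)
  have hF: "h x \<in> ?F" if "x < n" for x using that img by auto
  have inv: "inv_into {..<n} h X < n" "h (inv_into {..<n} h X) = X" if "X \<in> ?F" for X
    using that img inv_into_into[of X h "{..<n}"] f_inv_into_f[of X h "{..<n}"] by auto
  have top: "Z \<subseteq> {..<p + s}" if "Z \<in> flats p B s" for Z
    using that points by (cases rule: flats_cases) (auto dest: line_point_less)
  have rank_one: "\<exists>x<p. Z = {x}" if "Z \<in> ?F" "rank_flat p s Z = 1" for Z
    using that(1) by (cases rule: flats_cases) (use that rank_flat_simps in auto)
  interpret lattice ?L
    using h top flats_intros(2) flats_Int by (intro lattice_order_of) auto
  have lless: "x \<sqsubset>\<^bsub>?L\<^esub> y \<longleftrightarrow> h x \<subset> h y" if "x < n" "y < n" for x y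
    using inj that by (auto simp: lless_eq dest: inj_onD)
  show ?thesis
  proof unfold_locales
    show "inv_into {..<n} h {} \<in> carrier ?L" using inv(1)[OF flats_intros(1)] by simp
    show "inv_into {..<n} h {..<p + s} \<in> carrier ?L" using inv(1)[OF flats_intros(2)] by simp
    show "(rank_flat p s \<circ> h) (inv_into {..<n} h {}) = 0"
      using inv(2)[OF flats_intros(1)] rank_flat_simps(1) by simp
    show "(rank_flat p s \<circ> h) (inv_into {..<n} h {..<p + s}) = 3"
      using inv(2)[OF flats_intros(2)] rank_flat_simps(2) by simp
    show "inv_into {..<n} h {} \<sqsubseteq>\<^bsub>?L\<^esub> x" for x
      using inv(2)[OF flats_intros(1)] by simp
    show "x \<sqsubseteq>\<^bsub>?L\<^esub> inv_into {..<n} h {..<p + s}" if "x \<in> carrier ?L" for x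
      using inv(2)[OF flats_intros(2)] top[OF hF] that by simp
    show "(rank_flat p s \<circ> h) x < (rank_flat p s \<circ> h) y"
      if "x \<in> carrier ?L" "y \<in> carrier ?L" "x \<sqsubset>\<^bsub>?L\<^esub> y" for x y
      using that lless rank_flat_less hF by simp
    show "\<exists>a\<in>carrier ?L. (rank_flat p s \<circ> h) a = 1"
      using inv[OF flats_intros(3)[of 0]] points rank_flat_simps(3)[of s 0]
      by (intro bexI[of _ "inv_into {..<n} h {0}"]) auto
  next
    fix x assume x: "x \<in> carrier ?L" "(rank_flat p s \<circ> h) x = 2"
    have "h x \<noteq> {}" using x rank_flat_simps(1)[of s] by auto
    then have "\<exists>y<p. y \<in> h x" using hF[of x] x flat_has_point by simp
    then obtain y where "y < p" "y \<in> h x" by auto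
    then show "\<exists>a\<in>carrier ?L. (rank_flat p s \<circ> h) a = 1 \<and> a \<sqsubseteq>\<^bsub>?L\<^esub> x"
      using inv[OF flats_intros(3)[of y]] rank_flat_simps(3)
      by (intro bexI[of _ "inv_into {..<n} h {y}"]) auto
  next
    fix a b assume "a \<in> carrier ?L" "b \<in> carrier ?L"
      "(rank_flat p s \<circ> h) a = 1" "(rank_flat p s \<circ> h) b = 1"
    then obtain x y where xy: "x < p" "h a = {x}" "y < p" "h b = {y}"
      using rank_one[OF hF, of a] rank_one[OF hF, of b] by auto
    \<comment> \<open>If both atoms are the same point, any other point \<open>y'\<close> serves as
      partner, so that a line through \<open>x\<close> exists in this case too.\<close>
    obtain y' where y': "y' < p" "y' \<noteq> x" "y = x \<or> y' = y"
      using other_point[of x] xy by (cases "y = x") auto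
    obtain l where "l \<in> B" "x \<in> l" "y \<in> l"
      using line_through[OF xy(1) y'(1)] y' by auto
    then show "\<exists>l\<in>carrier ?L. (rank_flat p s \<circ> h) l = 2 \<and> a \<sqsubseteq>\<^bsub>?L\<^esub> l \<and> b \<sqsubseteq>\<^bsub>?L\<^esub> l"
      using inv[OF flats_intros(4)[of l]] rank_flat_simps(4) xy
      by (intro bexI[of _ "inv_into {..<n} h l"]) auto
  next
    fix x assume x: "x \<in> carrier ?L" "x \<noteq> inv_into {..<n} h {}" "x \<noteq> inv_into {..<n} h {..<p + s}"
    have xn: "x < n" using x(1) by simp
    have "inv_into {..<n} h (h x) = x" using inv_into_f_f[OF inj] xn by simp
    then have "h x \<noteq> {}" "h x \<noteq> {..<p + s}" using x(2,3) by metis+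
    then obtain Y where "Y \<in> ?F" "\<not> h x \<subseteq> Y \<and> \<not> Y \<subseteq> h x"
      using flat_incomparable[OF hF[OF xn]] by blast
    then show "\<exists>y\<in>carrier ?L. \<not> x \<sqsubseteq>\<^bsub>?L\<^esub> y \<and> \<not> y \<sqsubseteq>\<^bsub>?L\<^esub> x"
      using inv[of Y] by (intro bexI[of _ "inv_into {..<n} h Y"]) auto
  qed auto
qed

lemma order_of_flats_in_semimodular_vi3:
  assumes h: "bij_betw h {..<n} (flats p B s)"
  shows "order_of n h \<in> semimodular_vi3 n"
proof -
  interpret ranked3 "order_of n h" "rank_flat p s \<circ> h" "inv_into {..<n} h {}"
      "inv_into {..<n} h {..<p + s}"
    by (rule ranked3_order_of_flats[OF h])
  show ?thesis using vi_lattice semimodular has_rank by (simp add: semimodular_vi3_def)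
qed

end

section \<open>What an isomorphism class remembers of the flats\<close>

definition traces :: "nat \<Rightarrow> nat set set \<Rightarrow> nat set set" where
  "traces p F = (\<lambda>A. A \<inter> {..<p}) ` F"

text \<open>An isomorphism maps singletons to singletons and so induces a map of points that
  preserves and reflects incidence. Intersecting with \<open>{..<p}\<close> discards the elements
  \<open>p + k\<close>, on which this map is not defined. For a fixed second space the traces of the
  first are thus one of at most \<open>p ^ p\<close> families, one for each
  \<open>\<pi>\<close>.\<close>

lemma traces_of_iso:
  assumes "linear_space p B" "linear_space p B'"
    and h: "bij_betw h {..<n} (flats p B s)" and h': "bij_betw h' {..<n} (flats p B' s')"
    and iso: "gorder_iso (order_of n h) (order_of n h')"
  shows "\<exists>\<pi>\<in>{..<p} \<rightarrow>\<^sub>E {..<p}. traces p (flats p B s) = (\<lambda>A. {x\<in>{..<p}. \<pi> x \<in> A}) ` flats p B' s'"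
proof -
  interpret S: linear_space p B by fact
  interpret S': linear_space p B' by fact
  let ?F = "flats p B s" and ?G = "flats p B' s'"
  obtain g where g: "bij_betw g {..<n} {..<n}"
    "order_emb (order_of n h) (order_of n h') g"
    using iso unfolding gorder_iso_def order_of_simps by blast
  from g(2) have g_le: "h' (g x) \<subseteq> h' (g y) \<longleftrightarrow> h x \<subseteq> h y" if "x < n" "y < n" for x y
    using that unfolding order_emb_def order_of_simps by simp
  define \<phi> where "\<phi> = h' \<circ> (g \<circ> inv_into {..<n} h)"
  have inv: "bij_betw (inv_into {..<n} h) ?F {..<n}" using h by (rule bij_betw_inv_into)
  have \<phi>: "bij_betw \<phi> ?F ?G"
    unfolding \<phi>_def by (rule bij_betw_trans[OF bij_betw_trans[OF inv g(1)] h'])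
  have emb: "\<phi> X \<subseteq> \<phi> Y \<longleftrightarrow> X \<subseteq> Y" if "X \<in> ?F" "Y \<in> ?F" for X Y
    using that g_le[of "inv_into {..<n} h X" "inv_into {..<n} h Y"] bij_betwE[OF inv]
      bij_betw_inv_into_right[OF h] unfolding \<phi>_def by simp
  have img: "\<phi> ` ?F = ?G" using \<phi> by (simp add: bij_betw_def)
  obtain Z where "Z \<in> ?F" "\<phi> Z = {}" using img S'.flats_intros(1) by (metis imageE)
  then have empty: "\<phi> {} = {}" using emb[of "{}" Z] S.flats_intros(1) by auto
  have "\<exists>y<p. \<phi> {x} = {y}" if x: "x < p" for x
  proof -
    have xF: "{x} \<in> ?F" using S.flats_intros x by auto
    then have "\<phi> {x} \<in> ?G" using img by auto
    moreover have "\<phi> {x} \<noteq> {}" using emb[of "{x}" "{}"] empty xF S.flats_intros by auto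
    ultimately have "\<exists>y<p. y \<in> \<phi> {x}" using S'.flat_has_point by blast
    then obtain y where y: "y < p" "y \<in> \<phi> {x}" by auto
    \<comment> \<open>The preimage of \<open>{y}\<close> is a nonempty flat inside
      \<open>{x}\<close>, hence \<open>{x}\<close> itself.\<close>
    then have "{y} \<in> ?G" using S'.flats_intros by auto
    then obtain Y where Y: "Y \<in> ?F" "\<phi> Y = {y}" using img by (metis imageE)
    then have "Y \<subseteq> {x}" using emb[of Y "{x}"] xF y by auto
    moreover have "Y \<noteq> {}" using Y empty by auto
    ultimately have "Y = {x}" by auto
    then show ?thesis using y Y by auto
  qed
  then obtain q where q: "\<And>x. x < p \<Longrightarrow> q x < p \<and> \<phi> {x} = {q x}" by metis
  have mem: "{x\<in>{..<p}. restrict q {..<p} x \<in> \<phi> A} = A \<inter> {..<p}" if "A \<in> ?F" for A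
  proof -
    have "q x \<in> \<phi> A \<longleftrightarrow> x \<in> A" if "x < p" for x
      using emb[of "{x}" A] S.flats_intros(3)[of x] that q \<open>A \<in> ?F\<close> by auto
    then show ?thesis by auto
  qed
  have "traces p ?F = (\<lambda>A. {x\<in>{..<p}. restrict q {..<p} x \<in> A}) ` ?G"
    unfolding img[symmetric] image_image traces_def using mem by (intro image_cong) auto
  moreover have "restrict q {..<p} \<in> {..<p} \<rightarrow>\<^sub>E {..<p}" using q by auto
  ultimately show ?thesis by blast
qed

section \<open>Edge colourings of complete graphs\<close>

text \<open>The conflict relation \<open>R\<close> is arbitrary; colouring edges, with two edges in
  conflict when they meet, is the instance used.\<close>

definition proper_colourings :: "'a set \<Rightarrow> 'b set \<Rightarrow> ('a \<Rightarrow> 'a \<Rightarrow> bool) \<Rightarrow> ('a \<Rightarrow> 'b) set" where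
  "proper_colourings V C R = {f \<in> V \<rightarrow>\<^sub>E C. \<forall>x\<in>V. \<forall>y\<in>V. x \<noteq> y \<and> R x y \<longrightarrow> f x \<noteq> f y}"

text \<open>Greedy colouring: the element added last conflicts with at most \<open>d\<close>
  coloured ones, so every partial colouring leaves at least \<open>card C - d\<close> free colours,
  and different choices extend to different colourings.\<close>

lemma card_proper_colourings_ge:
  assumes "finite V" "finite C" "symp R" "\<And>x. x \<in> V \<Longrightarrow> card {y \<in> V. y \<noteq> x \<and> R x y} \<le> d"
  shows "(card C - d) ^ card V \<le> card (proper_colourings V C R)"
  using assms(1,4)
proof (induction V)
  case empty
  then show ?case by (simp add: proper_colourings_def)
next
  case (insert x V)
  let ?P = "proper_colourings V C R" and ?Q = "proper_colourings (insert x V) C R"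
  let ?free = "\<lambda>f. C - f ` {y \<in> V. R x y}"
  have sub: "{z \<in> V. z \<noteq> y \<and> R y z} \<subseteq> {z \<in> insert x V. z \<noteq> y \<and> R y z}" for y by auto
  have "card {z \<in> V. z \<noteq> y \<and> R y z} \<le> d" if "y \<in> V" for y
    using insert.prems[of y] card_mono[OF _ sub[of y]] insert.hyps(1) that by fastforce
  then have IH: "(card C - d) ^ card V \<le> card ?P" using insert.IH by blast
  have finP: "finite ?P" and finQ: "finite ?Q"
    using insert.hyps(1) assms(2) unfolding proper_colourings_def by (auto simp: finite_PiE)
  have "{y \<in> insert x V. y \<noteq> x \<and> R x y} = {y \<in> V. R x y}" using insert.hyps(2) by auto
  then have deg: "card {y \<in> V. R x y} \<le> d" using insert.prems[of x] by simp
  have free: "card C - d \<le> card (?free f)" for f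
  proof -
    have fin: "finite (f ` {y \<in> V. R x y})" using insert.hyps(1) by simp
    have "card (f ` {y \<in> V. R x y}) \<le> d"
      using deg card_image_le[of "{y \<in> V. R x y}" f] insert.hyps(1) by simp
    then show ?thesis using diff_card_le_card_Diff[OF fin, of C] by linarith
  qed
  have "(card C - d) ^ card (insert x V) \<le> (card C - d) * card ?P"
    using insert.hyps IH by simp
  also have "\<dots> \<le> (\<Sum>f\<in>?P. card (?free f))"
    using sum_mono[of ?P "\<lambda>_. card C - d" "\<lambda>f. card (?free f)"] free by (simp add: mult.commute)
  also have "\<dots> = card (Sigma ?P ?free)" using finP assms(2) by simp
  also have "\<dots> \<le> card ?Q"
  proof (rule card_inj_on_le[OF _ _ finQ])
    show "inj_on (\<lambda>(f, c). f(x := c)) (Sigma ?P ?free)"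
    proof (rule inj_onI, clarsimp)
      fix f c g c' assume f: "f \<in> ?P" and g: "g \<in> ?P" and eq: "f(x := c) = g(x := c')"
      \<comment> \<open>Both functions are extensional on \<open>V\<close>, hence
        \<open>undefined\<close> at \<open>x\<close>; equality after the updates therefore gives
        equality before them.\<close>
      have "f x = g x" using f g insert.hyps(2) by (auto simp: proper_colourings_def PiE_def extensional_def)
      moreover have "f y = g y" if "y \<noteq> x" for y using fun_cong[OF eq, of y] that by simp
      ultimately have "f = g" by (metis ext)
      then show "f = g \<and> c = c'" using fun_cong[OF eq, of x] by simp
    qed
    show "(\<lambda>(f, c). f(x := c)) ` Sigma ?P ?free \<subseteq> ?Q"
    proof clarsimp
      fix f c assume f: "f \<in> ?P" and c: "c \<in> C" "c \<notin> f ` {y \<in> V. R x y}"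
      have "f(x := c) \<in> insert x V \<rightarrow>\<^sub>E C"
        using f c by (auto simp: proper_colourings_def PiE_def extensional_def)
      moreover have "(f(x := c)) y \<noteq> (f(x := c)) z"
        if "y \<in> insert x V" "z \<in> insert x V" "y \<noteq> z" "R y z" for y z
        using that f c sympD[OF assms(3), of y z] by (auto simp: proper_colourings_def)
      ultimately show "f(x := c) \<in> ?Q" unfolding proper_colourings_def by blast
    qed
  qed
  finally show ?case .
qed

definition edges :: "nat \<Rightarrow> nat set set" where
  "edges v = {e. e \<subseteq> {..<v} \<and> card e = 2}"

text \<open>Colours start at \<open>v\<close>, so that vertices and colours are disjoint and
  together form the point set \<open>{..<v + m}\<close>.\<close>

definition edge_colourings :: "nat \<Rightarrow> nat \<Rightarrow> (nat set \<Rightarrow> nat) set" where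
  "edge_colourings v m = proper_colourings (edges v) {v..<v + m} (\<lambda>e e'. e \<inter> e' \<noteq> {})"

lemma finite_edges: "finite (edges v)"
  unfolding edges_def by (rule finite_subset[of _ "Pow {..<v}"]) auto

lemma card_edges: "card (edges v) = v choose 2"
  unfolding edges_def using n_subsets[of "{..<v}" 2] by simp

text \<open>An edge meeting \<open>e\<close> has the form \<open>{a, b}\<close> with
  \<open>a\<close> one of the two ends of \<open>e\<close> and \<open>b\<close> one of the
  \<open>v\<close> vertices, so there are at most \<open>2 * v\<close> conflicts.\<close>

lemma card_edge_colourings_ge: "(m - 2 * v) ^ (v choose 2) \<le> card (edge_colourings v m)"
proof -
  have "card {e' \<in> edges v. e' \<noteq> e \<and> e \<inter> e' \<noteq> {}} \<le> 2 * v" if e: "e \<in> edges v" for e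
  proof -
    have fe: "finite e" "card e = 2" using e finite_subset[of e "{..<v}"] by (auto simp: edges_def)
    have "{e' \<in> edges v. e' \<noteq> e \<and> e \<inter> e' \<noteq> {}} \<subseteq> (\<lambda>(a, b). {a, b}) ` (e \<times> {..<v})"
    proof
      fix e' assume e': "e' \<in> {e' \<in> edges v. e' \<noteq> e \<and> e \<inter> e' \<noteq> {}}"
      then obtain a where a: "a \<in> e" "a \<in> e'" by auto
      have "card e' = 2" "e' \<subseteq> {..<v}" using e' by (auto simp: edges_def)
      then obtain b where "e' = {a, b}" "b < v" using a(2) by (auto simp: card_2_iff)
      then show "e' \<in> (\<lambda>(a, b). {a, b}) ` (e \<times> {..<v})" using a by auto
    qed
    then have "card {e' \<in> edges v. e' \<noteq> e \<and> e \<inter> e' \<noteq> {}} \<le> card ((\<lambda>(a, b). {a, b}) ` (e \<times> {..<v}))"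
      using fe by (intro card_mono) auto
    also have "\<dots> \<le> card (e \<times> {..<v})" using fe by (intro card_image_le) auto
    finally show ?thesis using fe by simp
  qed
  then have "(card {v..<v + m} - 2 * v) ^ card (edges v) \<le> card (edge_colourings v m)"
    unfolding edge_colourings_def
    by (intro card_proper_colourings_ge finite_edges) (auto intro: sympI)
  then show ?thesis by (simp add: card_edges)
qed

section \<open>The linear space of an edge colouring\<close>

definition lines :: "nat \<Rightarrow> nat \<Rightarrow> (nat set \<Rightarrow> nat) \<Rightarrow> nat set set" where
  "lines v m f = (\<lambda>e. insert (f e) e) ` edges v
     \<union> (\<lambda>(i, c). {i, c}) ` ({..<v} \<times> {v..<v + m} - {(i, f e) | i e. e \<in> edges v \<and> i \<in> e})
     \<union> {{v..<v + m}}"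

lemma edge_cases:
  assumes "e \<in> edges v"
  obtains x y where "x \<noteq> y" "x < v" "y < v" "e = {x, y}"
  using assms unfolding edges_def card_2_iff by auto

lemma edgeI: "x < v \<Longrightarrow> y < v \<Longrightarrow> x \<noteq> y \<Longrightarrow> {x, y} \<in> edges v"
  by (simp add: edges_def)

context
  fixes v m f
  assumes f: "f \<in> edge_colourings v m"
begin

lemma colour_range: "e \<in> edges v \<Longrightarrow> v \<le> f e \<and> f e < v + m"
  using f by (auto simp: edge_colourings_def proper_colourings_def dest: PiE_mem)

lemma colour_inj: "e \<in> edges v \<Longrightarrow> e' \<in> edges v \<Longrightarrow> x \<in> e \<Longrightarrow> x \<in> e' \<Longrightarrow> f e = f e' \<Longrightarrow> e = e'"
  using f by (auto simp: edge_colourings_def proper_colourings_def)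

lemma lines_cases:
  assumes "b \<in> lines v m f"
  obtains (triple) e where "e \<in> edges v" "b = insert (f e) e"
    | (pair) i c where "i < v" "v \<le> c" "c < v + m" "b = {i, c}"
        "\<And>e. e \<in> edges v \<Longrightarrow> i \<in> e \<Longrightarrow> f e \<noteq> c"
    | (colours) "b = {v..<v + m}"
  using assms unfolding lines_def by fastforce

text \<open>This lemma, \<open>line_vertex_colour\<close> and \<open>line_two_colours\<close> treat
  the three types of pairs of points. Each writes the line in terms of the two points alone, so
  uniqueness of lines follows by rewriting.\<close>

lemma line_two_vertices:
  assumes "b \<in> lines v m f" "x \<in> b" "y \<in> b" "x < v" "y < v" "x \<noteq> y"
  shows "b = insert (f {x, y}) {x, y}"
  using assms(1)
proof (cases rule: lines_cases)
  case (triple e)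
  obtain a c where "e = {a, c}" using triple edge_cases by metis
  moreover have "x \<in> e" "y \<in> e" using triple colour_range[of e] assms by auto
  ultimately have "e = {x, y}" using assms(6) by auto
  then show ?thesis using triple by simp
qed (use assms in auto)

text \<open>A colour occurs on at most one edge at a given vertex, so the \<open>THE\<close> term is
  well defined; if it occurs on none, the line is a pair.\<close>

lemma line_vertex_colour:
  assumes "b \<in> lines v m f" "x \<in> b" "y \<in> b" "x < v" "v \<le> y"
  shows "b = (if \<exists>e\<in>edges v. x \<in> e \<and> f e = y
              then insert y (THE e. e \<in> edges v \<and> x \<in> e \<and> f e = y) else {x, y})"
  using assms(1)
proof (cases rule: lines_cases)
  case (triple e)
  have "e \<subseteq> {..<v}" using triple by (simp add: edges_def)
  then have xy: "x \<in> e" "f e = y" using triple assms colour_range[of e] by auto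
  then have "(THE e. e \<in> edges v \<and> x \<in> e \<and> f e = y) = e"
    using triple(1) colour_inj[OF _ triple(1) _ xy(1)] by (intro the_equality) blast+
  then show ?thesis using triple xy by auto
next
  case (pair i c)
  then have "x = i" "y = c" using assms by auto
  then show ?thesis using pair by auto
qed (use assms in auto)

lemma line_two_colours:
  assumes "b \<in> lines v m f" "x \<in> b" "y \<in> b" "v \<le> x" "v \<le> y" "x \<noteq> y"
  shows "b = {v..<v + m}"
  using assms(1)
proof (cases rule: lines_cases)
  case (triple e)
  then have "e \<subseteq> {..<v}" by (simp add: edges_def)
  then have "x = f e" "y = f e" using triple assms by auto
  then show ?thesis using assms(6) by simp
qed (use assms in auto)

lemma line_ex_vertex_colour:
  assumes "x < v" "v \<le> y" "y < v + m"
  shows "\<exists>b\<in>lines v m f. x \<in> b \<and> y \<in> b"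
proof (cases "\<exists>e\<in>edges v. x \<in> e \<and> f e = y")
  case True
  then obtain e where e: "e \<in> edges v" "x \<in> e" "f e = y" by auto
  then have "insert (f e) e \<in> lines v m f" unfolding lines_def by blast
  then show ?thesis by (rule bexI[rotated]) (use e in simp)
next
  case False
  then have "(x, y) \<in> {..<v} \<times> {v..<v + m} - {(i, f e) | i e. e \<in> edges v \<and> i \<in> e}"
    using assms by auto
  from imageI[OF this, of "\<lambda>(i, c). {i, c}"] have "{x, y} \<in> lines v m f"
    unfolding lines_def by simp
  then show ?thesis by (rule bexI[rotated]) simp
qed

lemma linear_space_lines:
  assumes v: "1 \<le> v" and m: "2 \<le> m"
  shows "linear_space (v + m) (lines v m f)"
proof
  show "2 \<le> v + m" using m by simp
next
  fix b assume b: "b \<in> lines v m f"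
  have "b \<subseteq> {..<v + m}"
    using b
  proof (cases rule: lines_cases)
    case (triple e)
    then show ?thesis using colour_range[of e] by (auto simp: edges_def)
  qed auto
  \<comment> \<open>A vertex and two colours are never collinear, since the only line with two
    colours is the set of all colours. Hence no line contains all points.\<close>
  moreover have "\<not> {0, v, v + 1} \<subseteq> b"
    using b
  proof (cases rule: lines_cases)
    case (triple e)
    then have "e \<subseteq> {..<v}" by (simp add: edges_def)
    then have "v \<notin> e" "v + 1 \<notin> e" by auto
    then show ?thesis using triple by auto
  next
    case (pair i c)
    then show ?thesis using v by auto
  qed (use v in auto)
  moreover have "{0, v, v + 1} \<subseteq> {..<v + m}" using v m by auto
  ultimately show "b \<subset> {..<v + m}" by blast
  show "\<exists>x\<in>b. \<exists>y\<in>b. x \<noteq> y"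
    using b
  proof (cases rule: lines_cases)
    case (triple e)
    then show ?thesis using edge_cases[of e v] by (metis insert_iff)
  next
    case (pair i c)
    then show ?thesis by auto
  next
    case colours
    then have "v \<in> b" "v + 1 \<in> b" using m by auto
    then show ?thesis by (intro bexI[of _ v] bexI[of _ "v + 1"]) auto
  qed
next
  fix x y assume xy: "x < v + m" "y < v + m" "x \<noteq> y"
  consider "x < v" "y < v" | "x < v" "v \<le> y" | "y < v" "v \<le> x" | "v \<le> x" "v \<le> y" by linarith
  then show "\<exists>b\<in>lines v m f. x \<in> b \<and> y \<in> b"
  proof cases
    case 1
    then have "insert (f {x, y}) {x, y} \<in> lines v m f"
      using xy edgeI[of x v y] by (simp add: lines_def)
    then show ?thesis by (rule bexI[rotated]) simp
  next
    case 4
    have "{v..<v + m} \<in> lines v m f" by (simp add: lines_def)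
    then show ?thesis by (rule bexI[rotated]) (use 4 xy in simp)
  qed (use line_ex_vertex_colour[of x y] line_ex_vertex_colour[of y x] xy in auto)
next
  fix x y b c assume h: "x \<noteq> y" "b \<in> lines v m f" "c \<in> lines v m f" "x \<in> b" "y \<in> b" "x \<in> c" "y \<in> c"
  consider "x < v" "y < v" | "x < v" "v \<le> y" | "y < v" "v \<le> x" | "v \<le> x" "v \<le> y" by linarith
  then show "b = c"
  proof cases
    case 1
    then show ?thesis using line_two_vertices[of b x y] line_two_vertices[of c x y] h by simp
  next
    case 2
    then show ?thesis using line_vertex_colour[of b x y] line_vertex_colour[of c x y] h by simp
  next
    case 3
    then show ?thesis using line_vertex_colour[of b y x] line_vertex_colour[of c y x] h by simp
  next
    case 4
    then show ?thesis using line_two_colours[of b x y] line_two_colours[of c x y] h by simp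
  qed
qed

text \<open>There are at most \<open>v choose 2\<close> triples and one line of colours. Each edge
  rules out two of the \<open>v * m\<close> vertex-colour pairs, and by properness these are
  distinct, which leaves \<open>v * m - 2 * (v choose 2)\<close> pairs.\<close>

lemma card_lines_le: "card (lines v m f) + (v choose 2) \<le> v * m + 1"
proof -
  let ?K = "{(i, f e) | i e. e \<in> edges v \<and> i \<in> e}"
  let ?A = "(\<lambda>e. insert (f e) e) ` edges v"
  let ?D = "{..<v} \<times> {v..<v + m} - ?K"
  have K: "?K = (\<lambda>(e, i). (i, f e)) ` Sigma (edges v) (\<lambda>e. e)" by (auto simp: image_iff)
  have fin: "finite e" if "e \<in> edges v" for e
    using that finite_subset[of e "{..<v}"] by (auto simp: edges_def)
  have "inj_on (\<lambda>(e, i). (i, f e)) (Sigma (edges v) (\<lambda>e. e))"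
    using colour_inj by (auto simp: inj_on_def)
  then have "card ?K = card (Sigma (edges v) (\<lambda>e. e))" unfolding K by (rule card_image)
  also have "\<dots> = (\<Sum>e\<in>edges v. card e)" using finite_edges fin by simp
  also have "\<dots> = 2 * (v choose 2)" using card_edges by (simp add: edges_def)
  finally have cK: "card ?K = 2 * (v choose 2)" .
  have sub: "?K \<subseteq> {..<v} \<times> {v..<v + m}" using colour_range by (auto simp: edges_def)
  have cD: "card ?D = v * m - 2 * (v choose 2)"
    using cK card_Diff_subset[OF finite_subset[OF sub] sub] by simp
  have le: "2 * (v choose 2) \<le> v * m"
    using card_mono[OF _ sub] cK by simp
  have "card (lines v m f) \<le> card ?A + card ((\<lambda>(i, c). {i, c}) ` ?D) + card {{v..<v + m}}"
    unfolding lines_def by (meson card_Un_le add_mono le_refl order_trans)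
  also have "\<dots> \<le> (v choose 2) + card ?D + 1"
    using card_image_le[OF finite_edges, of "\<lambda>e. insert (f e) e" v]
      card_image_le[of ?D "\<lambda>(i, c). {i, c}"] card_edges[of v] by simp
  finally show ?thesis using cD le by simp
qed

end

text \<open>The colour of \<open>e\<close> can be read off the traces. A trace consisting of
  \<open>e\<close> and one colour comes from a line: the top would contribute the two colours
  \<open>v\<close> and \<open>v + 1\<close>, and an extra set leaves only \<open>{0}\<close>. The
  line through the two vertices of \<open>e\<close> is the triple of \<open>e\<close>.\<close>

lemma triple_in_traces:
  assumes f: "f \<in> edge_colourings v m" and vm: "1 \<le> v" "2 \<le> m" and e: "e \<in> edges v"
    and c: "v \<le> c" "c < v + m"
  shows "insert c e \<in> traces (v + m) (flats (v + m) (lines v m f) s) \<longleftrightarrow> c = f e"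
proof
  interpret linear_space "v + m" "lines v m f" by (rule linear_space_lines[OF f vm])
  obtain x y where xy: "x \<noteq> y" "x < v" "y < v" "e = {x, y}" using e by (rule edge_cases)
  {
    assume "insert c e \<in> traces (v + m) (flats (v + m) (lines v m f) s)"
    then obtain A where A: "A \<in> flats (v + m) (lines v m f) s" "insert c e = A \<inter> {..<v + m}"
      by (auto simp: traces_def)
    from A(1) have "A \<in> lines v m f"
    proof (cases rule: flats_cases)
      case 2
      have "{..<v + m + s} \<inter> {..<v + m} = {..<v + m}" by auto
      then have "insert c e = {..<v + m}" using A(2) 2 by simp
      moreover have "v \<in> {..<v + m}" "v + 1 \<in> {..<v + m}" using vm by auto
      ultimately have "v \<in> insert c e" "v + 1 \<in> insert c e" by simp_all
      then have "v = c" "v + 1 = c" using xy by simp_all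
      then show ?thesis by simp
    next
      case (5 k)
      have "{x, y} \<subseteq> A \<inter> {..<v + m}" using A(2) xy(4) by blast
      then have "x = 0" "y = 0" using 5 xy by auto
      then show ?thesis using xy(1) by simp
    next
      case (3 z)
      then have "{x, y} \<subseteq> {z}" using A(2) xy(4) by blast
      then show ?thesis using xy(1) by simp
    qed (use A(2) in auto)
    moreover from this have "insert c e = A" using A line_point_less by auto
    ultimately have "insert c e = insert (f e) e"
      using line_two_vertices[OF f, of A x y] xy by blast
    then have "c \<in> insert (f e) e" by blast
    moreover have "c \<notin> e" using c xy by simp
    ultimately show "c = f e" by simp
  }
  assume "c = f e"
  then have "insert c e \<in> lines v m f" using e by (simp add: lines_def)
  moreover have "insert c e \<subseteq> {..<v + m}" using c xy by auto
  ultimately show "insert c e \<in> traces (v + m) (flats (v + m) (lines v m f) s)"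
    unfolding traces_def using flats_intros(4) by blast
qed

text \<open>The number of extra sets is allowed to vary with the colouring, because it compensates
  for the number of lines.\<close>

lemma inj_on_traces:
  assumes vm: "1 \<le> v" "2 \<le> m"
  shows "inj_on (\<lambda>f. traces (v + m) (flats (v + m) (lines v m f) (s f))) (edge_colourings v m)"
proof (rule inj_onI)
  fix f g assume f: "f \<in> edge_colourings v m" and g: "g \<in> edge_colourings v m"
    and eq: "traces (v + m) (flats (v + m) (lines v m f) (s f)) =
             traces (v + m) (flats (v + m) (lines v m g) (s g))"
  show "f = g"
  proof (rule PiE_ext)
    show "f \<in> edges v \<rightarrow>\<^sub>E {v..<v + m}" "g \<in> edges v \<rightarrow>\<^sub>E {v..<v + m}"
      using f g by (auto simp: edge_colourings_def proper_colourings_def)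
    fix e assume e: "e \<in> edges v"
    then show "f e = g e"
      using triple_in_traces[OF f vm e, of "f e" "s f"] triple_in_traces[OF g vm e, of "f e" "s g"]
        colour_range[OF f e] eq by simp
  qed
qed

section \<open>The lower bound\<close>

lemma card_le_fibres:
  assumes "finite Q" "c ` X \<subseteq> Q" "\<And>x. x \<in> X \<Longrightarrow> card {y \<in> X. c y = c x} \<le> k"
  shows "card X \<le> card Q * k"
proof -
  have "card {y \<in> X. c y = q} \<le> k" for q
  proof (cases "{y \<in> X. c y = q} = {}")
    case False
    then show ?thesis using assms(3) by auto
  next
    case True
    then show ?thesis by (metis card.empty le0)
  qed
  then have "(\<Sum>q\<in>Q. card {y \<in> X. c y = q}) \<le> card Q * k"
    using sum_bounded_above[of Q "\<lambda>q. card {y \<in> X. c y = q}" k] by simp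
  moreover have "X = (\<Union>q\<in>Q. {y \<in> X. c y = q})" using assms(2) by auto
  then have "card X \<le> (\<Sum>q\<in>Q. card {y \<in> X. c y = q})"
    using card_UN_le[OF assms(1), of "\<lambda>q. {y \<in> X. c y = q}"] by simp
  ultimately show ?thesis by linarith
qed

lemma num_semimodular_vi3_ge:
  assumes vm: "1 \<le> v" "2 \<le> m" and n: "3 + v + m + v * m \<le> n + (v choose 2)"
  shows "(m - 2 * v) ^ (v choose 2) \<le> num_semimodular_vi3 n * (v + m) ^ (v + m)"
proof -
  let ?p = "v + m" and ?X = "semimodular_vi3 n" and ?C = "edge_colourings v m"
  \<comment> \<open>The extra one-point lines bring every lattice to exactly \<open>n\<close>
    elements; assumption \<open>n\<close> and \<open>card_lines_le\<close> keep the subtraction from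
    being truncated.\<close>
  define s where "s f = n - (2 + ?p + card (lines v m f))" for f
  let ?F = "\<lambda>f. flats ?p (lines v m f) (s f)"
  define h where "h f = (SOME h. bij_betw h {..<n} (?F f))" for f
  define c where "c f = iso_rel ?X `` {order_of n (h f)}" for f
  have h: "bij_betw (h f) {..<n} (?F f)" if f: "f \<in> ?C" for f
  proof -
    interpret linear_space ?p "lines v m f" by (rule linear_space_lines[OF f vm])
    have "card (?F f) = n"
      using card_lines_le[OF f] n by (simp add: card_flats s_def)
    moreover have "finite (?F f)" using finite_lines by (simp add: flats_def)
    ultimately have "\<exists>h. bij_betw h {..<n} (?F f)"
      using ex_bij_betw_nat_finite[of "?F f"] by (simp add: atLeast0LessThan)
    then show ?thesis unfolding h_def by (rule someI_ex)
  qed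
  have L: "order_of n (h f) \<in> ?X" if f: "f \<in> ?C" for f
    using linear_space.order_of_flats_in_semimodular_vi3[OF linear_space_lines[OF f vm] h[OF f]] .
  have "card ?C \<le> card (?X // iso_rel ?X) * ?p ^ ?p"
  proof (rule card_le_fibres[where c = c])
    show "finite (?X // iso_rel ?X)" by (rule finite_semimodular_vi3_classes)
    show "c ` ?C \<subseteq> ?X // iso_rel ?X" unfolding c_def using L by (auto intro: quotientI)
    fix g assume g: "g \<in> ?C"
    let ?T = "\<lambda>\<pi>. (\<lambda>A. {x\<in>{..<?p}. \<pi> x \<in> A}) ` ?F g"
    let ?S = "{f \<in> ?C. c f = c g}"
    \<comment> \<open>All colourings in the class of \<open>g\<close> have traces that are pullbacks
      of the flats of \<open>g\<close> along some map of the points. Since the traces determine the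
      colouring, the fibre has at most \<open>?p ^ ?p\<close> members.\<close>
    have "traces ?p (?F f) \<in> ?T ` ({..<?p} \<rightarrow>\<^sub>E {..<?p})" if f: "f \<in> ?C" "c f = c g" for f
    proof -
      have "(order_of n (h f), order_of n (h g)) \<in> iso_rel ?X"
        using f L g unfolding c_def by (intro eq_equiv_class[OF _ equiv_iso_rel_semimodular_vi3])
      then have "gorder_iso (order_of n (h f)) (order_of n (h g))" by (simp add: iso_rel_def)
      then show ?thesis
        using traces_of_iso[OF linear_space_lines[OF f(1) vm] linear_space_lines[OF g vm] h[OF f(1)] h[OF g]]
        by blast
    qed
    then have "(\<lambda>f. traces ?p (?F f)) ` ?S \<subseteq> ?T ` ({..<?p} \<rightarrow>\<^sub>E {..<?p})" by auto
    moreover have "inj_on (\<lambda>f. traces ?p (?F f)) ?S"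
      using inj_on_traces[OF vm, of s] by (rule inj_on_subset) auto
    ultimately have "card ?S \<le> card (?T ` ({..<?p} \<rightarrow>\<^sub>E {..<?p}))"
      by (intro card_inj_on_le) (auto simp: finite_PiE)
    also have "\<dots> \<le> card ({..<?p} \<rightarrow>\<^sub>E {..<?p})" by (intro card_image_le) (simp add: finite_PiE)
    also have "\<dots> = ?p ^ ?p" by (simp add: card_PiE)
    finally show "card ?S \<le> ?p ^ ?p" .
  qed
  then show ?thesis
    using card_edge_colourings_ge[of m v] by (simp add: num_semimodular_vi3_def)
qed

section \<open>Numerical estimates\<close>

lemma num_semimodular_vi3_ge_power:
  assumes t: "1 \<le> t" and n: "28 * t\<^sup>2 + 15 * t + 3 \<le> n"
  shows "t ^ (8 * t\<^sup>2 - 2 * t) \<le> num_semimodular_vi3 n * (13 * t) ^ (13 * t)"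
proof -
  have "2 * t \<le> 8 * t\<^sup>2" using t by (simp add: power2_eq_square)
  moreover have "4 * t * (4 * t - 1) = 2 * (8 * t\<^sup>2 - 2 * t)"
    by (simp add: power2_eq_square algebra_simps diff_mult_distrib2)
  then have ch: "4 * t choose 2 = 8 * t\<^sup>2 - 2 * t" by (simp add: choose_two)
  \<comment> \<open>With \<open>v = 4 * t\<close> and \<open>m = 9 * t\<close> the base
    \<open>m - 2 * v\<close> is \<open>t\<close>, and
    \<open>3 + v + m + v * m - (v choose 2)\<close> is the assumed bound on
    \<open>n\<close>.\<close>
  ultimately have "3 + 4 * t + 9 * t + 4 * t * (9 * t) \<le> n + (4 * t choose 2)"
    using n by (simp add: power2_eq_square)
  from num_semimodular_vi3_ge[OF _ _ this] t ch show ?thesis by simp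
qed

text \<open>The left side is at most about \<open>7 * t\<^sup>2 * ln t - 14 * t\<^sup>2\<close>,
  while \<open>count\<close> leaves \<open>8 * t\<^sup>2 * ln t\<close> up to terms of order
  \<open>t * ln t\<close>; from \<open>t = 15\<close> on, \<open>14 * t\<^sup>2\<close> absorbs the
  latter.\<close>

lemma exponent_estimate:
  fixes t n b N :: real
  assumes t: "15 \<le> t" and n: "0 < n" "n \<le> 28 * t\<^sup>2 + 71 * t + 46"
    and b: "b = 0.3286 * n powr (1 / 8)" "1 < b" and N: "0 < N"
    and count: "(8 * t\<^sup>2 - 2 * t) * ln t \<le> ln N + 13 * t * ln (13 * t)"
  shows "n * ln b \<le> ln N"
proof -
  let ?x = "ln t"
  have tt: "15 * t \<le> t\<^sup>2" using t by (simp add: power2_eq_square)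
  then have nN: "n \<le> 28 * t\<^sup>2 + 75 * t" and n33: "n \<le> 33 * t\<^sup>2" using n t by linarith+
  \<comment> \<open>The constant 0.3286 enters here: the bound 4 on the logarithm, divided by 8,
    becomes the \<open>1 / 2\<close> subtracted in \<open>lnb\<close>.\<close>
  have "exp (4::real) = exp 1 ^ 4" by (simp flip: exp_of_nat_mult)
  also have "\<dots> \<le> 3 ^ 4" using exp_le by (intro power_mono) auto
  also have "\<dots> \<le> 1 / (33 * 0.3286 ^ 8)" by (simp add: field_simps)
  finally have "4 \<le> ln (1 / (33 * 0.3286 ^ 8 :: real))" by (subst ln_ge_iff) auto
  also have "\<dots> = - (ln 33 + 8 * ln (0.3286 :: real))"
  proof -
    have "ln (1 / (33 * a ^ 8)) = - (ln 33 + 8 * ln a)" if "0 < a" for a :: real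
      using that by (simp add: ln_div ln_mult ln_realpow)
    then show ?thesis by simp
  qed
  finally have c: "8 * ln (0.3286 :: real) + ln 33 \<le> -4" by simp
  have ln2: "ln 2 \<le> (1 :: real)" using ln_le_minus_one[of 2] by simp
  have "ln n \<le> ln (33 * t\<^sup>2)" using n33 n(1) by (rule ln_mono)
  also have "\<dots> = ln 33 + 2 * ?x" using t by (simp add: ln_mult ln_realpow)
  finally have lnn: "ln n \<le> ln 33 + 2 * ?x" .
  have ln_prod: "ln (a * n powr (1 / 8)) = ln a + ln n / 8" if "0 < a" for a
    using that n by (simp add: ln_mult ln_powr)
  have "ln b = ln 0.3286 + ln n / 8" unfolding b(1) by (rule ln_prod) simp
  then have lnb: "ln b \<le> ?x / 4 - 1 / 2" using lnn c by linarith
  have "0 < ln b" using b(2) by simp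
  then have "n * ln b \<le> (28 * t\<^sup>2 + 75 * t) * (?x / 4 - 1 / 2)"
    using lnb nN n by (intro mult_mono) auto
  also have "\<dots> \<le> (8 * t\<^sup>2 - 2 * t) * ?x - 13 * t * (4 + ?x)"
  proof -
    \<comment> \<open>Splitting off the factor 4 gives a bound on \<open>ln t\<close> of slope
      \<open>1 / 4\<close>, so that \<open>135 / 4 * (t * ln t)\<close> stays below
      \<open>14 * t\<^sup>2\<close> with room for the linear terms.\<close>
    have "ln t = ln (t / 4) + 2 * ln 2" using t ln_realpow[of 2 2] by (simp add: ln_div)
    moreover have "ln (t / 4) \<le> t / 4 - 1" using t by (intro ln_le_minus_one) simp
    ultimately have "?x \<le> t / 4 + 1" using ln2 by linarith
    then have "t * ?x \<le> t * (t / 4 + 1)" using t by (intro mult_left_mono) auto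
    also have "\<dots> = t\<^sup>2 / 4 + t" by (simp add: power2_eq_square algebra_simps)
    finally have "t * ?x \<le> t\<^sup>2 / 4 + t" .
    moreover have "0 \<le> t\<^sup>2 * ?x" using t by simp
    \<comment> \<open>Comparing coefficients on both sides gives
      \<open>135 / 4 = 75 / 4 + 2 + 13\<close> and \<open>29 / 2 = 52 - 75 / 2\<close>.\<close>
    ultimately have "29 / 2 * t + 135 / 4 * (t * ?x) \<le> t\<^sup>2 * ?x + 14 * t\<^sup>2"
      using tt t by linarith
    then show ?thesis by (simp add: algebra_simps)
  qed
  also have "\<dots> \<le> (8 * t\<^sup>2 - 2 * t) * ?x - 13 * t * ln (13 * t)"
  proof -
    have "ln (13 :: real) \<le> ln (2 ^ 4)" by (subst ln_le_cancel_iff) auto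
    also have "\<dots> = 4 * ln 2" by (subst ln_realpow) auto
    finally have "ln (13 :: real) \<le> 4" using ln2 by simp
    then have "ln (13 * t) \<le> 4 + ?x" using t by (simp add: ln_mult)
    then have "13 * t * ln (13 * t) \<le> 13 * t * (4 + ?x)" using t by (intro mult_left_mono) auto
    then show ?thesis by simp
  qed
  also have "\<dots> \<le> ln N" using count by simp
  finally show ?thesis .
qed

theorem theorem5:
  fixes n :: nat
  assumes "n \<ge> 100"
  shows "real (num_semimodular_vi3 n) \<ge> (0.3286 * real n powr (1 / 8)) ^ n"
proof -
  define q where "q t = 28 * t\<^sup>2 + 15 * t + 3" for t :: nat
  let ?S = "{t. q t \<le> n}"
  have fin: "finite ?S"
    by (rule finite_subset[of _ "{..n}"]) (auto simp: q_def)
  define t where "t = Max ?S"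
  have "1 \<in> ?S" using assms by (simp add: q_def)
  then have t1: "1 \<le> t" using fin by (simp add: t_def)
  have "t \<in> ?S" unfolding t_def using fin \<open>1 \<in> ?S\<close> by (intro Max_in) auto
  then have qt: "28 * t\<^sup>2 + 15 * t + 3 \<le> n" by (simp add: q_def)
  have "Suc t \<notin> ?S" using Max_ge[OF fin, of "Suc t"] by (fold t_def) linarith
  then have nt: "n < 28 * t\<^sup>2 + 71 * t + 46" by (simp add: q_def power2_eq_square algebra_simps)
  let ?N = "num_semimodular_vi3 n" and ?b = "0.3286 * real n powr (1 / 8)"
  have count: "t ^ (8 * t\<^sup>2 - 2 * t) \<le> ?N * (13 * t) ^ (13 * t)"
    using num_semimodular_vi3_ge_power[OF t1 qt] .
  moreover have "0 < t ^ (8 * t\<^sup>2 - 2 * t)" using t1 by simp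
  ultimately have N: "0 < ?N" by (metis gr0I leD mult_zero_left)
  show ?thesis
  \<comment> \<open>For a base of at most 1 it is enough that some lattice exists, which is
    \<open>N\<close>.\<close>
  proof (cases "?b \<le> 1")
    case True
    then have "?b ^ n \<le> 1" by (intro power_le_one) auto
    then show ?thesis using N by linarith
  next
    case False
    \<comment> \<open>The number 3.04 is slightly less than \<open>1 / 0.3286\<close>.\<close>
    have "3.04 ^ 8 \<le> (real n powr (1 / 8)) ^ 8" using False by (intro power_mono) simp_all
    also have "\<dots> = real n" using assms by (simp add: powr_power)
    finally have "3.04 ^ 8 \<le> real n" .
    moreover have "7000 < (3.04 :: real) ^ 8" by (simp add: power_divide)
    ultimately have "7000 < n" by linarith
    \<comment> \<open>For \<open>t \<le> 14\<close> the bound \<open>nt\<close> would give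
      \<open>n < 6528\<close>.\<close>
    have "15 \<le> t"
    proof (rule ccontr)
      assume "\<not> 15 \<le> t"
      then have "t \<le> 14" by simp
      then have "t\<^sup>2 \<le> 14\<^sup>2" by (intro power_mono) auto
      then show False using nt \<open>7000 < n\<close> \<open>t \<le> 14\<close> by simp
    qed
    have "2 * t \<le> 8 * t\<^sup>2" using t1 by (simp add: power2_eq_square)
    then have ex: "real (8 * t\<^sup>2 - 2 * t) = 8 * (real t)\<^sup>2 - 2 * real t" by (simp add: of_nat_diff)
    have "real t ^ (8 * t\<^sup>2 - 2 * t) \<le> real ?N * (13 * real t) ^ (13 * t)"
      using of_nat_mono[OF count, where 'a = real] by simp
    then have "ln (real t ^ (8 * t\<^sup>2 - 2 * t)) \<le> ln (real ?N * (13 * real t) ^ (13 * t))"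
      using t1 N by (subst ln_le_cancel_iff) auto
    then have "(8 * (real t)\<^sup>2 - 2 * real t) * ln (real t)
        \<le> ln (real ?N) + 13 * real t * ln (13 * real t)"
      using t1 N ex by (simp add: ln_mult_pos ln_realpow distrib_left)
    moreover have "real n \<le> 28 * (real t)\<^sup>2 + 71 * real t + 46"
      using of_nat_mono[OF less_imp_le[OF nt], where 'a = real] by simp
    ultimately have "real n * ln ?b \<le> ln (real ?N)"
      using \<open>15 \<le> t\<close> False N assms
      by (intro exponent_estimate[of "real t" "real n" ?b "real ?N"]) auto
    moreover have b: "0 < ?b" using False by linarith
    ultimately have "ln (?b ^ n) \<le> ln (real ?N)" using ln_realpow[of ?b n] by linarith
    then show ?thesis using zero_less_power[OF b, of n] N by (subst (asm) ln_le_cancel_iff) simp_all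
  qed
qed

end
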